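(* Let $n\ge 3$, $r_1,\ldots,r_n\ge 2$ integers, $t\in[n]$ and $s=n-1$. The ideal $\widetilde{I}^{\langle n-1,t\rangle}$ of $R$ defines a rational normal scroll; that is, there exist $l\in\mathbb{N}_+$, positive integers $\sigma_1\le\cdots\le\sigma_l$, and a bijection between the variables of $R$ and the variables $Z_{i,j}$ ($i\in[l]$, $1\le j\le\sigma_i+1$) such that the induced ring isomorphism maps $\widetilde{I}^{\langle n-1,t\rangle}$ onto the defining ideal $I_2(\Sigma)$ of the rational normal scroll $\mathrm{Scr}(\sigma_1,\ldots,\sigma_l)$.
   Context: Notation: $[r]=\{1,\ldots,r\}$, $\mathcal{N}=[r_1]\times\cdots\times[r_n]$, $\Bbbk$ is an arbitrary field. $R=\Bbbk[x_a: a\in\mathcal{N}]$ is the polynomial ring where the variables are identified by $x_a=x_b$ if and only if $\sum_{i=1}^{n-1} a_i=\sum_{i=1}^{n-1} b_i$ and $a_n=b_n$ (so variables correspond bijectively to equivalence classes). For $i\in[n]$ and $a,b\in\mathcal{N}$, $\mathrm{sw}(i,a,b)\in\mathcal{N}$ is obtained from $a$ by replacing its $i$-th component by $b_i$, and $f_{i,a,b}=x_ax_b-x_{\mathrm{sw}(i,a,b)}x_{\mathrm{sw}(i,b,a)}$. The ideal $\widetilde{I}^{\langle n-1,t\rangle}\subseteq R$ is generated by all $f_{i,a,b}$ with $a,b\in\mathcal{N}$ and $i\in[t]$. Rational normal scrolls: for positive integers $\sigma_1\le\cdots\le\sigma_l$ and $m=\sum_{i=1}^l\sigma_i+l-1$,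 take complementary linear subspaces $\Lambda_i\subseteq\mathbb{P}^m$ of dimension $\sigma_i$, rational normal curves $\mathcal{C}_i\subseteq\Lambda_i$, biregular maps $\varphi_i:\mathcal{C}_1\to\mathcal{C}_i$, and let $\mathrm{Scr}(\sigma_1,\ldots,\sigma_l)$ be the union over $P\in\mathcal{C}_1$ of the linear spans of $P,\varphi_2(P),\ldots,\varphi_l(P)$. Its defining ideal $I_2(\Sigma)\subseteq\Bbbk[Z_{i,j}: i\in[l],\ 1\le j\le\sigma_i+1]$ is generated by the $2\times 2$ minors of the $2\times(\sigma_1+\cdots+\sigma_l)$ matrix $$\Sigma=\left(\begin{matrix}Z_{1,1}&Z_{1,2}&\cdots&Z_{1,\sigma_1}\\ Z_{1,2}&Z_{1,3}&\cdots&Z_{1,\sigma_1+1}\end{matrix}\ \middle|\ \begin{matrix}\cdots\\ \cdots\end{matrix}\ \middle|\ \begin{matrix}Z_{l,1}&Z_{l,2}&\cdots&Z_{l,\sigma_l}\\ Z_{l,2}&Z_{l,3}&\cdots&Z_{l,\sigma_l+1}\end{matrix}\right)$$ consisting of $l$ Hankel blocks of sizes $2\times\sigma_i$. *)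

theory Defs
  imports
    "HOL-Library.Poly_Mapping"
    "HOL-Library.FuncSet"
    "HOL-Algebra.Algebra"
    "HOL-Algebra.Algebraic_Closure_Type"
begin

type_synonym ('v, 'k) mpoly = "('v \<Rightarrow>\<^sub>0 nat) \<Rightarrow>\<^sub>0 'k"

definition Var :: "'v \<Rightarrow> ('v, 'k::comm_ring_1) mpoly" where
  "Var v = Poly_Mapping.single (Poly_Mapping.single v 1) 1"

definition Const :: "'k \<Rightarrow> ('v, 'k::comm_ring_1) mpoly" where
  "Const c = Poly_Mapping.single 0 c"

definition polys_in :: "'v set \<Rightarrow> ('v, 'k::comm_ring_1) mpoly set" where
  "polys_in V = {p. \<forall>m \<in> Poly_Mapping.keys p. Poly_Mapping.keys m \<subseteq> V}"

definition mpoly_ring :: "'v set \<Rightarrow> ('v, 'k::comm_ring_1) mpoly ring" where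
  "mpoly_ring V = ring_of_type_algebra\<lparr>carrier := polys_in V\<rparr>"

lemma Var_in_polys_in: "v \<in> V \<Longrightarrow> Var v \<in> polys_in V"
  by (simp add: Var_def polys_in_def)

lemma polys_in_closed:
  shows "1 \<in> polys_in V"
    and "p \<in> polys_in V \<Longrightarrow> - p \<in> polys_in V"
    and "p \<in> polys_in V \<Longrightarrow> q \<in> polys_in V \<Longrightarrow> p + q \<in> polys_in V"
    and "p \<in> polys_in V \<Longrightarrow> q \<in> polys_in V \<Longrightarrow> p - q \<in> polys_in V"
    and "p \<in> polys_in V \<Longrightarrow> q \<in> polys_in V \<Longrightarrow> p * q \<in> polys_in V"
proof -
  show "1 \<in> polys_in V"
    by (simp add: polys_in_def)
  show "p \<in> polys_in V \<Longrightarrow> - p \<in> polys_in V"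
    by (simp add: polys_in_def)
  show "p \<in> polys_in V \<Longrightarrow> q \<in> polys_in V \<Longrightarrow> p + q \<in> polys_in V"
    using Poly_Mapping.keys_add[of p q] by (auto simp: polys_in_def)
  show "p \<in> polys_in V \<Longrightarrow> q \<in> polys_in V \<Longrightarrow> p - q \<in> polys_in V"
    using keys_diff[of p q] by (auto simp: polys_in_def)
  show "p * q \<in> polys_in V" if p: "p \<in> polys_in V" and q: "q \<in> polys_in V"
    unfolding polys_in_def
  proof (clarify)
    fix m v assume m: "m \<in> Poly_Mapping.keys (p * q)" and v: "v \<in> Poly_Mapping.keys m"
    from m obtain a b where ab: "m = a + b" "a \<in> Poly_Mapping.keys p" "b \<in> Poly_Mapping.keys q"
      using keys_mult[of p q] by auto
    show "v \<in> V"
      using v Poly_Mapping.keys_add[of a b] ab p q by (auto simp: polys_in_def)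
  qed
qed

lemma cring_mpoly_ring: "cring (mpoly_ring V :: ('v, 'k::comm_ring_1) mpoly ring)"
proof -
  interpret T: cring "ring_of_type_algebra :: ('v, 'k) mpoly ring"
    by (rule cring_from_type_algebra)
  have minus: "\<ominus>\<^bsub>ring_of_type_algebra\<^esub> p = - p" for p :: "('v, 'k) mpoly"
    by (rule T.minus_equality) (simp_all add: ring_of_type_algebra_def)
  have "subring (polys_in V) (ring_of_type_algebra :: ('v, 'k) mpoly ring)"
    by (rule T.subringI, simp_all add: minus)
       (simp_all add: ring_of_type_algebra_def polys_in_closed)
  then show ?thesis
    unfolding mpoly_ring_def using T.subcringI' T.subcring_iff by (simp add: ring_of_type_algebra_def)
qed

text \<open>
  Elements of \<open>\<N> = [r\<^sub>1] \<times> \<cdots> \<times> [r\<^sub>n]\<close> are 1-based functions, undefined outside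
  \<open>{1..n}\<close>.  The identification of the variables is implemented by taking
  the equivalence classes themselves as the variables.
\<close>

definition index_set :: "nat \<Rightarrow> (nat \<Rightarrow> nat) \<Rightarrow> (nat \<Rightarrow> nat) set" where
  "index_set n r = (\<Pi>\<^sub>E i\<in>{1..n}. {1..r i})"

definition index_rel :: "nat \<Rightarrow> (nat \<Rightarrow> nat) \<Rightarrow> ((nat \<Rightarrow> nat) \<times> (nat \<Rightarrow> nat)) set" where
  "index_rel n r = {(a, b). a \<in> index_set n r \<and> b \<in> index_set n r \<and>
     (\<Sum>i=1..n-1. a i) = (\<Sum>i=1..n-1. b i) \<and> a n = b n}"

lemma equiv_index_rel: "equiv (index_set n r) (index_rel n r)"
  by (rule equivI) (auto simp: index_rel_def refl_on_def sym_def trans_def)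

definition var_classes :: "nat \<Rightarrow> (nat \<Rightarrow> nat) \<Rightarrow> (nat \<Rightarrow> nat) set set" where
  "var_classes n r = index_set n r // index_rel n r"

definition xvar :: "nat \<Rightarrow> (nat \<Rightarrow> nat) \<Rightarrow> (nat \<Rightarrow> nat) \<Rightarrow> ((nat \<Rightarrow> nat) set, 'k::comm_ring_1) mpoly" where
  "xvar n r a = Var (index_rel n r `` {a})"

definition sw :: "nat \<Rightarrow> (nat \<Rightarrow> nat) \<Rightarrow> (nat \<Rightarrow> nat) \<Rightarrow> (nat \<Rightarrow> nat)" where
  "sw i a b = a(i := b i)"

definition switch_binomial ::
  "nat \<Rightarrow> (nat \<Rightarrow> nat) \<Rightarrow> nat \<Rightarrow> (nat \<Rightarrow> nat) \<Rightarrow> (nat \<Rightarrow> nat) \<Rightarrow> ((nat \<Rightarrow> nat) set, 'k::comm_ring_1) mpoly" where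
  "switch_binomial n r i a b =
     xvar n r a * xvar n r b - xvar n r (sw i a b) * xvar n r (sw i b a)"

definition switch_ring :: "nat \<Rightarrow> (nat \<Rightarrow> nat) \<Rightarrow> ((nat \<Rightarrow> nat) set, 'k::comm_ring_1) mpoly ring" where
  "switch_ring n r = mpoly_ring (var_classes n r)"

definition switch_generators ::
  "nat \<Rightarrow> (nat \<Rightarrow> nat) \<Rightarrow> nat \<Rightarrow> ((nat \<Rightarrow> nat) set, 'k::comm_ring_1) mpoly set" where
  "switch_generators n r t = {switch_binomial n r i a b | i a b.
     i \<in> {1..t} \<and> a \<in> index_set n r \<and> b \<in> index_set n r}"

definition switch_ideal ::
  "nat \<Rightarrow> (nat \<Rightarrow> nat) \<Rightarrow> nat \<Rightarrow> ((nat \<Rightarrow> nat) set, 'k::comm_ring_1) mpoly set" where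
  "switch_ideal n r t = Idl\<^bsub>switch_ring n r\<^esub> (switch_generators n r t)"

lemma switch_generators_carrier:
  assumes "t \<le> n"
  shows "switch_generators n r t \<subseteq> carrier (switch_ring n r)"
proof -
  have sw: "sw i a b \<in> index_set n r"
    if "i \<in> {1..t}" "a \<in> index_set n r" "b \<in> index_set n r" for i a b
    using that assms by (auto simp: sw_def index_set_def PiE_iff extensional_def)
  have x: "xvar n r a \<in> polys_in (var_classes n r)" if "a \<in> index_set n r" for a
    unfolding xvar_def var_classes_def using that by (intro Var_in_polys_in quotientI)
  show ?thesis
    by (auto simp: switch_generators_def switch_ring_def mpoly_ring_def switch_binomial_def
        intro!: polys_in_closed x sw)
qed

text \<open>
  The scroll ideal: \<open>(i, j)\<close> with \<open>1 \<le> j \<le> \<sigma>\<^sub>i\<close> labels the \<open>j\<close>-th column of the \<open>i\<close>-th Hankel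
  block of \<open>\<Sigma>\<close>, and the columns are ordered lexicographically, as in the displayed block matrix.
  The row index is 1 or 2.
\<close>

definition scroll_vars :: "nat \<Rightarrow> (nat \<Rightarrow> nat) \<Rightarrow> (nat \<times> nat) set" where
  "scroll_vars l \<sigma> = (SIGMA i:{1..l}. {1..\<sigma> i + 1})"

definition scroll_columns :: "nat \<Rightarrow> (nat \<Rightarrow> nat) \<Rightarrow> (nat \<times> nat) set" where
  "scroll_columns l \<sigma> = (SIGMA i:{1..l}. {1..\<sigma> i})"

definition scroll_entry :: "nat \<Rightarrow> nat \<times> nat \<Rightarrow> (nat \<times> nat, 'k::comm_ring_1) mpoly" where
  "scroll_entry row c = Var (fst c, snd c + (row - 1))"

definition column_before :: "nat \<times> nat \<Rightarrow> nat \<times> nat \<Rightarrow> bool" where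
  "column_before c d \<longleftrightarrow> fst c < fst d \<or> fst c = fst d \<and> snd c < snd d"

definition scroll_minors :: "nat \<Rightarrow> (nat \<Rightarrow> nat) \<Rightarrow> (nat \<times> nat, 'k::comm_ring_1) mpoly set" where
  "scroll_minors l \<sigma> =
     {scroll_entry 1 c * scroll_entry 2 d - scroll_entry 1 d * scroll_entry 2 c | c d.
        c \<in> scroll_columns l \<sigma> \<and> d \<in> scroll_columns l \<sigma> \<and> column_before c d}"

definition scroll_ring :: "nat \<Rightarrow> (nat \<Rightarrow> nat) \<Rightarrow> (nat \<times> nat, 'k::comm_ring_1) mpoly ring" where
  "scroll_ring l \<sigma> = mpoly_ring (scroll_vars l \<sigma>)"

definition scroll_ideal :: "nat \<Rightarrow> (nat \<Rightarrow> nat) \<Rightarrow> (nat \<times> nat, 'k::comm_ring_1) mpoly set" where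
  "scroll_ideal l \<sigma> = Idl\<^bsub>scroll_ring l \<sigma>\<^esub> (scroll_minors l \<sigma>)"

lemma scroll_minors_carrier: "scroll_minors l \<sigma> \<subseteq> carrier (scroll_ring l \<sigma>)"
proof -
  have e: "scroll_entry row c \<in> polys_in (scroll_vars l \<sigma>)"
    if "c \<in> scroll_columns l \<sigma>" "row \<in> {1, 2}" for row c
    unfolding scroll_entry_def using that
    by (intro Var_in_polys_in) (auto simp: scroll_vars_def scroll_columns_def)
  show ?thesis
    by (auto simp: scroll_minors_def scroll_ring_def mpoly_ring_def
        intro!: polys_in_closed e)
qed

text \<open>
  \<open>induced_iso V W \<phi> \<Phi>\<close>: \<open>\<Phi>\<close> is the ring isomorphism \<open>k[V] \<rightarrow> k[W]\<close> that fixes the constants and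
  acts on the variables by \<open>\<phi>\<close>; these conditions determine \<open>\<Phi>\<close> on \<open>k[V]\<close>.
\<close>

definition induced_iso ::
  "'v set \<Rightarrow> 'w set \<Rightarrow> ('v \<Rightarrow> 'w) \<Rightarrow> (('v, 'k::comm_ring_1) mpoly \<Rightarrow> ('w, 'k) mpoly) \<Rightarrow> bool" where
  "induced_iso V W \<phi> \<Phi> \<longleftrightarrow>
     \<Phi> \<in> ring_iso (mpoly_ring V) (mpoly_ring W) \<and>
     (\<forall>c. \<Phi> (Const c) = Const c) \<and>
     (\<forall>v \<in> V. \<Phi> (Var v) = Var (\<phi> v))"

end

theory Submission
  imports Defs
begin

text \<open>
  A variable of \<open>R\<close> is determined by the last coordinate \<open>c = a\<^sub>n\<close> of an index \<open>a\<close> and by the amount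
  \<open>p\<close> by which \<open>a\<^sub>1 + \<cdots> + a\<^bsub>n-1\<^esub>\<close> exceeds its minimum \<open>n - 1\<close> (the \<open>excess\<close>).  Every value between
  \<open>0\<close> and \<open>D = (r\<^sub>1 - 1) + \<cdots> + (r\<^bsub>n-1\<^esub> - 1)\<close> occurs, for every \<open>c\<close>.  So the variables form
  \<open>r\<^sub>n\<close> rows of length \<open>D + 1\<close>, and the scroll is \<open>Scr(D, \<dots>, D)\<close> with \<open>r\<^sub>n\<close> equal blocks, where
  the variable \<open>(c, p)\<close> goes to \<open>Z\<^bsub>c,p+1\<^esub>\<close>.

  Write \<open>z c p\<close> for this variable.  Both ideals then say that \<open>z c p * z d q\<close> depends
  on \<open>c\<close>, \<open>d\<close> and \<open>p + q\<close> only.  The minors of \<open>\<Sigma>\<close> are, up to sign, the unit exchanges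
  \<open>z c p * z d (q + 1) - z c (p + 1) * z d q\<close>.  Chaining them gives all exchanges
  with constant \<open>p + q\<close> (\<open>exchange_from_steps\<close>).  A switch in a coordinate \<open>i < n\<close> is of this kind,
  because it moves an amount between the two coordinate sums and keeps both last coordinates; so is a
  switch in coordinate \<open>n\<close>, because exchanging the last coordinates is the same as exchanging the
  two excesses.  Hence the switch ideal lies in the scroll ideal, for every \<open>t\<close>.

  Conversely, the switches in the first coordinate alone yield every unit exchange.  Such a switch exists
  only when the two indices can be chosen with first coordinates that differ by one,
  which fails if \<open>p\<close> and \<open>q\<close> are far apart.  In that case both sides of the unit exchange are moved by
  one switch each to a common third product.  This uses a slack of at least \<open>1\<close> in the
  coordinates \<open>2, \<dots>, n - 1\<close>, which is where \<open>n \<ge> 3\<close> enters (\<open>step_from_switches\<close>).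
\<close>

section \<open>Change of variables in polynomial rings\<close>

text \<open>
  Pushing a finitely supported function forward along a map of its index set, adding up the values over
  each fibre.  Applied to exponent vectors it renames the variables of a monomial, and applied to
  polynomials along that renaming it substitutes variables for variables.  Since \<open>f\<close> need not be
  injective off the support, a bijection between two sets of variables is enough, whatever the
  ambient types are.
\<close>

definition push :: "('a \<Rightarrow> 'b) \<Rightarrow> ('a \<Rightarrow>\<^sub>0 'c::comm_monoid_add) \<Rightarrow> ('b \<Rightarrow>\<^sub>0 'c)" where
  "push f p = (\<Sum>k\<in>Poly_Mapping.keys p. Poly_Mapping.single (f k) (Poly_Mapping.lookup p k))"

lemma push_superset:
  assumes "finite K" "Poly_Mapping.keys p \<subseteq> K"
  shows "push f p = (\<Sum>k\<in>K. Poly_Mapping.single (f k) (Poly_Mapping.lookup p k))"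
  unfolding push_def using assms
  by (intro sum.mono_neutral_left) (auto simp: in_keys_iff)

lemma push_zero [simp]: "push f 0 = 0"
  by (simp add: push_def)

lemma push_single [simp]: "push f (Poly_Mapping.single k c) = Poly_Mapping.single (f k) c"
  by (cases "c = 0") (simp_all add: push_def)

lemma push_add: "push f (p + q) = push f p + push f q"
proof -
  define K where "K = Poly_Mapping.keys p \<union> Poly_Mapping.keys q"
  have K: "finite K" "Poly_Mapping.keys p \<subseteq> K" "Poly_Mapping.keys q \<subseteq> K" 
    "Poly_Mapping.keys (p + q) \<subseteq> K"
    using Poly_Mapping.keys_add[of p q] by (auto simp: K_def)
  show ?thesis
    unfolding push_superset[OF K(1,2)] push_superset[OF K(1,3)] push_superset[OF K(1,4)]
    by (simp add: lookup_add single_add sum.distrib)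
qed

lemma push_diff:
  fixes p q :: "'a \<Rightarrow>\<^sub>0 'c::ab_group_add"
  shows "push f (p - q) = push f p - push f q"
  using push_add[of f "p - q" q] by simp

lemma push_sum: "push f (sum g A) = (\<Sum>x\<in>A. push f (g x))"
  by (induction A rule: infinite_finite_induct) (simp_all add: push_add)

lemma sum_singles_eq:
  "(\<Sum>k\<in>Poly_Mapping.keys p. Poly_Mapping.single k (Poly_Mapping.lookup p k)) = p"
  by (intro poly_mapping_eqI) 
     (auto simp: lookup_sum lookup_single when_def in_keys_iff sum.delta' cong: if_cong)

text \<open>
  Multiplication is convolution of singletons, so bilinearity reduces the claim to
  \<open>single a x * single b y = single (a + b) (x * y)\<close>.
\<close>

lemma push_mult:
  fixes p q :: "'a::monoid_add \<Rightarrow>\<^sub>0 'c::comm_semiring_0"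
  assumes "\<And>a b. f (a + b) = f a + (f b :: 'b::monoid_add)"
  shows "push f (p * q) = push f p * push f q"
proof -
  let ?s = "\<lambda>p k. Poly_Mapping.single k (Poly_Mapping.lookup p k)"
  have "push f (p * q) = push f ((\<Sum>a\<in>Poly_Mapping.keys p. ?s p a) * (\<Sum>b\<in>Poly_Mapping.keys q. ?s q b))"
    by (simp only: sum_singles_eq)
  also have "\<dots> = (\<Sum>a\<in>Poly_Mapping.keys p. \<Sum>b\<in>Poly_Mapping.keys q. push f (?s p a * ?s q b))"
    by (simp only: sum_product push_sum)
  also have "\<dots> = (\<Sum>a\<in>Poly_Mapping.keys p. \<Sum>b\<in>Poly_Mapping.keys q.
      push f (?s p a) * push f (?s q b))"
    by (simp add: mult_single assms)
  also have "\<dots> = push f p * push f q"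
    unfolding push_single by (simp only: sum_product push_def)
  finally show ?thesis .
qed

lemma keys_push: "Poly_Mapping.keys (push f p) \<subseteq> f ` Poly_Mapping.keys p"
  unfolding push_def by (rule order.trans[OF keys_sum]) auto

lemma push_inverse:
  assumes "\<And>k. k \<in> Poly_Mapping.keys p \<Longrightarrow> g (f k) = k"
  shows "push g (push f p) = p"
proof -
  have "push g (push f p) =
      (\<Sum>k\<in>Poly_Mapping.keys p. Poly_Mapping.single (g (f k)) (Poly_Mapping.lookup p k))"
    unfolding push_def[of f] by (simp add: push_sum)
  also have "\<dots> = p"
    by (subst (2) sum_singles_eq[symmetric]) (simp add: assms)
  finally show ?thesis .
qed

abbreviation rename_vars :: "('v \<Rightarrow> 'w) \<Rightarrow> ('v, 'k::comm_ring_1) mpoly \<Rightarrow> ('w, 'k) mpoly" where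
  "rename_vars \<phi> \<equiv> push (push \<phi>)"

lemma rename_vars_closed:
  assumes "\<phi> ` V \<subseteq> W" "p \<in> polys_in V"
  shows "rename_vars \<phi> p \<in> polys_in W"
  using assms keys_push[of "push \<phi>" p] keys_push[of \<phi>]
  unfolding polys_in_def by fastforce

lemma rename_vars_inverse:
  assumes "\<And>v. v \<in> V \<Longrightarrow> \<psi> (\<phi> v) = v" "p \<in> polys_in V"
  shows "rename_vars \<psi> (rename_vars \<phi> p) = p"
  using assms by (intro push_inverse) (auto simp: polys_in_def)

lemma carrier_mpoly_ring [simp]: "carrier (mpoly_ring V) = polys_in V"
  by (simp add: mpoly_ring_def)

lemma mpoly_ring_ops [simp]:
  "p \<otimes>\<^bsub>mpoly_ring V\<^esub> q = p * q" "p \<oplus>\<^bsub>mpoly_ring V\<^esub> q = p + q"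
  "\<one>\<^bsub>mpoly_ring V\<^esub> = 1" "\<zero>\<^bsub>mpoly_ring V\<^esub> = 0"
  by (simp_all add: mpoly_ring_def ring_of_type_algebra_def)

text \<open>The two-sided inverse is the renaming along the inverse bijection.\<close>

lemma rename_vars_induced_iso:
  fixes \<phi> :: "'v \<Rightarrow> 'w"
  assumes "bij_betw \<phi> V W"
  shows "induced_iso V W \<phi> (rename_vars \<phi> :: ('v, 'k::comm_ring_1) mpoly \<Rightarrow> ('w, 'k) mpoly)"
proof -
  let ?\<Phi> = "rename_vars \<phi> :: ('v, 'k) mpoly \<Rightarrow> ('w, 'k) mpoly"
  define \<psi> where "\<psi> = inv_into V \<phi>"
  have im: "\<phi> ` V \<subseteq> W" "\<psi> ` W \<subseteq> V"
    and inv: "\<And>v. v \<in> V \<Longrightarrow> \<psi> (\<phi> v) = v" "\<And>w. w \<in> W \<Longrightarrow> \<phi> (\<psi> w) = w"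
    using assms bij_betw_inv_into[OF assms] unfolding \<psi>_def
    by (auto simp: bij_betw_def inv_into_f_f f_inv_into_f)
  have "bij_betw ?\<Phi> (polys_in V) (polys_in W)"
  proof (rule bij_betwI[where g = "rename_vars \<psi>"])
    show "rename_vars \<psi> (?\<Phi> p) = p" if "p \<in> polys_in V" for p
      by (rule rename_vars_inverse[of V]) (use inv that in auto)
    show "?\<Phi> (rename_vars \<psi> q) = q" if "q \<in> polys_in W" for q
      by (rule rename_vars_inverse[of W]) (use inv that in auto)
  qed (auto intro: rename_vars_closed[OF im(1)] rename_vars_closed[OF im(2)])
  then have "?\<Phi> \<in> ring_iso (mpoly_ring V) (mpoly_ring W)"
    by (intro ring_iso_memI)
       (auto simp: push_add push_mult single_one[symmetric] simp del: single_one
             intro: rename_vars_closed[OF im(1)])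
  then show ?thesis
    by (simp add: induced_iso_def Const_def Var_def)
qed

section \<open>Ideals under ring isomorphisms\<close>

text \<open>
  Preimages of ideals under homomorphisms are ideals.  The two inclusions follow by taking preimages
  under \<open>h\<close> and under its inverse, together with minimality of generated ideals.
\<close>

lemma ring_iso_image_genideal:
  assumes R: "ring R" and S: "ring S" and h: "h \<in> ring_iso R S" and A: "A \<subseteq> carrier R"
  shows "h ` (Idl\<^bsub>R\<^esub> A) = Idl\<^bsub>S\<^esub> (h ` A)"
proof -
  define g where "g = inv_into (carrier R) h"
  have g: "g \<in> ring_iso S R"
    unfolding g_def by (rule ring_iso_set_sym[OF R h])
  have bij: "bij_betw h (carrier R) (carrier S)"
    using h by (simp add: ring_iso_def)
  have gh: "g (h x) = x" if "x \<in> carrier R" for x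
    using bij that by (simp add: g_def bij_betw_def)
  have hg: "h (g y) = y" "g y \<in> carrier R" if "y \<in> carrier S" for y
    using bij that by (auto simp: g_def bij_betw_def f_inv_into_f inv_into_into)
  have hA: "h ` A \<subseteq> carrier S"
    using A bij by (auto simp: bij_betw_def)
  interpret h: ring_hom_ring R S h
    using R S h by (intro ring_hom_ringI2) (auto simp: ring_iso_def)
  interpret g: ring_hom_ring S R g
    using R S g by (intro ring_hom_ringI2) (auto simp: ring_iso_def)
  show ?thesis
  proof
    have "Idl\<^bsub>R\<^esub> A \<subseteq> {x \<in> carrier R. h x \<in> Idl\<^bsub>S\<^esub> (h ` A)}"
      using A h.S.genideal_self[OF hA]
      by (intro h.R.genideal_minimal h.ideal_vimage h.S.genideal_ideal hA) auto
    then show "h ` (Idl\<^bsub>R\<^esub> A) \<subseteq> Idl\<^bsub>S\<^esub> (h ` A)"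
      by auto
    have "Idl\<^bsub>S\<^esub> (h ` A) \<subseteq> {y \<in> carrier S. g y \<in> Idl\<^bsub>R\<^esub> A}"
      using A hA h.R.genideal_self[OF A]
      by (intro h.S.genideal_minimal g.ideal_vimage h.R.genideal_ideal A)
         (auto simp: gh subset_iff)
    then show "Idl\<^bsub>S\<^esub> (h ` A) \<subseteq> h ` (Idl\<^bsub>R\<^esub> A)"
      by (force simp: hg intro: rev_image_eqI)
  qed
qed

lemma ideal_mpoly_ring_diff:
  fixes J :: "('v, 'k::comm_ring_1) mpoly set"
  assumes "ideal J (mpoly_ring V)" "p \<in> J" "q \<in> J"
  shows "p - q \<in> J"
proof -
  interpret ideal J "mpoly_ring V" by fact
  have "- 1 \<in> carrier (mpoly_ring V :: ('v, 'k) mpoly ring)"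
    by (simp add: polys_in_closed)
  then have "- 1 * q \<in> J"
    using I_l_closed[OF assms(3)] by (simp only: mpoly_ring_ops)
  then show ?thesis
    using additive_subgroup.a_closed[OF additive_subgroup_axioms assms(2)]
    by (simp only: mpoly_ring_ops) fastforce
qed

section \<open>Chains of exchanges\<close>

text \<open>
  In the two lemmas below \<open>F p q\<close> stands for the product \<open>z c p * z d q\<close> with \<open>c\<close> and \<open>d\<close> fixed,
  and membership of a difference in \<open>J\<close> is a congruence.

  One can walk from \<open>(p, q)\<close> to \<open>(p', q')\<close> along the antidiagonal by unit steps; all
  intermediate points stay in the square \<open>{0..D} \<times> {0..D}\<close> because they lie between the two endpoints.
\<close>

lemma exchange_from_steps:
  fixes F :: "nat \<Rightarrow> nat \<Rightarrow> 'a::ab_group_add"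
  assumes zero: "0 \<in> J" and diff: "\<And>x y. x \<in> J \<Longrightarrow> y \<in> J \<Longrightarrow> x - y \<in> J"
    and step: "\<And>p q. p < D \<Longrightarrow> q < D \<Longrightarrow> F p (Suc q) - F (Suc p) q \<in> J"
    and "p + q = p' + q'" "p \<le> D" "q \<le> D" "p' \<le> D" "q' \<le> D"
  shows "F p q - F p' q' \<in> J"
proof -
  have neg: "y - x \<in> J" if "x - y \<in> J" for x y
    using diff[OF zero that] by simp
  have trans: "x - z \<in> J" if "x - y \<in> J" "y - z \<in> J" for x y z
    using diff[OF that(1) neg[OF that(2)]] by simp
  have up: "F p (q + k) - F (p + k) q \<in> J" if "p + k \<le> D" "q + k \<le> D" for p q k
    using that
  proof (induction k arbitrary: p)
    case 0
    then show ?case using zero by simp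
  next
    case (Suc k)
    from Suc.prems have "F p (Suc (q + k)) - F (Suc p) (q + k) \<in> J"
      by (intro step) auto
    moreover from Suc.prems have "F (Suc p) (q + k) - F (Suc p + k) q \<in> J"
      by (intro Suc.IH) auto
    ultimately have "F p (Suc (q + k)) - F (Suc p + k) q \<in> J"
      by (rule trans)
    then show ?case by simp
  qed
  show ?thesis
  proof (cases "p \<le> p'")
    case True
    then have "q = q' + (p' - p)" using assms(4) by simp
    then show ?thesis
      using up[of p "p' - p" q'] True assms(4-) by simp
  next
    case False
    then have "q' = q + (p - p')" using assms(4) by simp
    then have "F p' q' - F p q \<in> J"
      using up[of p' "p - p'" q] False assms(4-) by simp
    then show ?thesis by (rule neg)
  qed
qed

text \<open>
  Here \<open>u\<close> and \<open>u'\<close> are the parts of the two excesses that come from the first coordinate and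
  \<open>v\<close>, \<open>v'\<close> those from the coordinates \<open>2, \<dots>, n - 1\<close>; a switch swaps \<open>u\<close> and \<open>u'\<close>.  A
  unit step is a single switch if \<open>u' = u + 1\<close> can be arranged, which means
  \<open>\<bar>p - q\<bar> \<le> B\<close>.  Otherwise the larger excess gets \<open>B\<close>, all it can get, from the later coordinates,
  and two switches meet: if \<open>p > q + B\<close>, swapping \<open>p - B\<close> with \<open>q\<close> takes
  \<open>(p, q + 1)\<close> to \<open>(q + B, p - B + 1)\<close>, and swapping \<open>p + 1 - B\<close> with \<open>q\<close> takes
  \<open>(p + 1, q)\<close> to the same place.  In the first of these the second excess is \<open>q + 1\<close> with
  first-coordinate part \<open>q\<close>, so the later coordinates must supply \<open>1 \<le> B\<close>.
\<close>

lemma step_from_switches: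
  fixes F :: "nat \<Rightarrow> nat \<Rightarrow> 'a::ab_group_add"
  assumes diff: "\<And>x y. x \<in> J \<Longrightarrow> y \<in> J \<Longrightarrow> x - y \<in> J"
    and switch: "\<And>u v u' v'. \<lbrakk>u \<le> A; u' \<le> A; v \<le> B; v' \<le> B\<rbrakk> \<Longrightarrow>
        F (u + v) (u' + v') - F (u' + v) (u + v') \<in> J"
    and A: "1 \<le> A" and B: "1 \<le> B" and pq: "p < A + B" "q < A + B"
  shows "F p (Suc q) - F (Suc p) q \<in> J"
proof -
  have two: "x - y \<in> J" if "x - z \<in> J" "y - z \<in> J" for x y z
    using diff[OF that] by simp
  consider (near) "p \<le> q + B" "q \<le> p + B" | (left) "q + B < p" | (right) "p + B < q"
    by linarith
  then show ?thesis
  proof cases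
    case near
    \<comment> \<open>the least first-coordinate part that leaves at most \<open>B\<close> of both \<open>p\<close> and \<open>q\<close>\<close>
    define u where "u = max (p - B) (q - B)"
    have u: "Suc u \<le> A" "u \<le> p" "u \<le> q" "p - u \<le> B" "q - u \<le> B"
      using near pq A B unfolding u_def by auto
    show ?thesis
      using switch[of u "Suc u" "p - u" "q - u"] u pq by auto
  next
    case left
    have "F p (Suc q) - F (q + B) (p - B + 1) \<in> J"
      using switch[of "p - B" q B 1] left pq B by simp
    moreover have "F (Suc p) q - F (q + B) (p - B + 1) \<in> J"
      using switch[of "Suc p - B" q B 0] left pq B by (simp add: Suc_diff_le)
    ultimately show ?thesis by (rule two)
  next
    case right
    have "F p (Suc q) - F (q - B + 1) (p + B) \<in> J"
      using switch[of p "Suc q - B" 0 B] right pq B by (simp add: Suc_diff_le)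
    moreover have "F (Suc p) q - F (q - B + 1) (p + B) \<in> J"
      using switch[of p "q - B" 1 B] right pq B by simp
    ultimately show ?thesis by (rule two)
  qed
qed

section \<open>Coordinate sums of index tuples\<close>

text \<open>Each coordinate in turn takes as much of the required surplus \<open>v\<close> as it can hold.\<close>

lemma PiE_sum_attained:
  fixes r :: "'a \<Rightarrow> nat"
  assumes "finite I" "\<And>i. i \<in> I \<Longrightarrow> 1 \<le> r i" "v \<le> (\<Sum>i\<in>I. r i - 1)"
  shows "\<exists>f \<in> \<Pi>\<^sub>E i\<in>I. {1..r i}. sum f I = card I + v"
  using assms
proof (induction I arbitrary: v rule: finite_induct)
  case empty
  then show ?case by simp
next
  case (insert i I)
  define x where "x = min v (r i - 1)"
  have "v - x \<le> (\<Sum>i\<in>I. r i - 1)"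
    using insert.prems(2) insert.hyps by (simp add: x_def)
  with insert obtain f where f: "f \<in> (\<Pi>\<^sub>E i\<in>I. {1..r i})" "sum f I = card I + (v - x)"
    by (metis insertCI)
  have "f(i := Suc x) \<in> (\<Pi>\<^sub>E i\<in>insert i I. {1..r i})"
    using f insert.prems(1)[of i] by (intro PiE_fun_upd) (auto simp: x_def insert.hyps)
  moreover have "sum (f(i := Suc x)) (insert i I) = Suc x + sum f I"
    using insert.hyps by (simp cong: sum.cong_simp) (intro sum.cong, auto)
  then have "sum (f(i := Suc x)) (insert i I) = card (insert i I) + v"
    using f insert.hyps by (simp add: x_def)
  ultimately show ?case by blast
qed

definition excess :: "nat \<Rightarrow> (nat \<Rightarrow> nat) \<Rightarrow> nat" where
  "excess n a = (\<Sum>i=1..n-1. a i) - (n - 1)"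

definition max_excess :: "nat \<Rightarrow> (nat \<Rightarrow> nat) \<Rightarrow> nat" where
  "max_excess n r = (\<Sum>i=1..n-1. r i - 1)"

definition scroll_position :: "nat \<Rightarrow> (nat \<Rightarrow> nat) \<Rightarrow> nat \<times> nat" where
  "scroll_position n a = (a n, Suc (excess n a))"

lemma coordinate_sum:
  assumes "a \<in> index_set n r"
  shows "(\<Sum>i=1..n-1. a i) = n - 1 + excess n a" "excess n a \<le> max_excess n r"
proof -
  have a: "1 \<le> a i" "a i \<le> r i" if "i \<in> {1..n-1}" for i
    using assms that PiE_mem[of a "{1..n}" "\<lambda>i. {1..r i}" i] by (auto simp: index_set_def)
  have "(\<Sum>i=1..n-1. 1) \<le> (\<Sum>i=1..n-1. a i)"
    using a by (intro sum_mono)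
  then show 1: "(\<Sum>i=1..n-1. a i) = n - 1 + excess n a"
    by (simp add: excess_def)
  have "(\<Sum>i=1..n-1. a i) \<le> (\<Sum>i=1..n-1. 1 + (r i - 1))"
    using a by (intro sum_mono) force
  also have "\<dots> = n - 1 + max_excess n r"
    by (simp add: sum.distrib max_excess_def del: One_nat_def)
  finally show "excess n a \<le> max_excess n r"
    using 1 by simp
qed

lemma index_set_last:
  assumes "a \<in> index_set n r" "1 \<le> n"
  shows "a n \<in> {1..r n}"
  using PiE_mem[of a "{1..n}" "\<lambda>i. {1..r i}" n] assms by (simp add: index_set_def)

lemma sum_split_first:
  assumes "2 \<le> (n::nat)"
  shows "(\<Sum>i=1..n-1. f i :: nat) = f 1 + (\<Sum>i=2..n-1. f i)"
  using assms sum.atLeast_Suc_atMost[of 1 "n - 1" f] by (simp add: numeral_2_eq_2)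

text \<open>
  The last coordinate, the first coordinate and the surplus in the remaining ones can be prescribed
  independently.  This supplies both the surjectivity onto the scroll variables and the
  indices that are switched to produce the minors.
\<close>

lemma index_tuple_exists:
  assumes n: "2 \<le> n" and r: "\<And>i. i \<in> {1..n} \<Longrightarrow> 1 \<le> r i"
    and c: "c \<in> {1..r n}" and u: "u \<le> r 1 - 1" and v: "v \<le> (\<Sum>i=2..n-1. r i - 1)"
  shows "\<exists>a \<in> index_set n r. a n = c \<and> a 1 = Suc u \<and> excess n a = u + v"
proof -
  obtain f where f: "f \<in> (\<Pi>\<^sub>E i\<in>{2..n-1}. {1..r i})" "sum f {2..n-1} = card {2..n-1} + v"
    using PiE_sum_attained[of "{2..n-1}" r v] r v by force
  define a where "a = f(1 := Suc u, n := c)"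
  have a: "a n = c" "a 1 = Suc u" "\<And>i. i \<in> {2..n-1} \<Longrightarrow> a i = f i"
    using n by (auto simp: a_def)
  have "a \<in> index_set n r"
    unfolding index_set_def
  proof (rule PiE_I)
    show "a i \<in> {1..r i}" if i: "i \<in> {1..n}" for i
    proof -
      consider "i = n" | "i = 1" "i \<noteq> n" | "i \<in> {2..n-1}"
        using i by fastforce
      then show ?thesis
      proof cases
        case 3
        then show ?thesis using f(1) a(3)[of i] PiE_mem[of f "{2..n-1}" "\<lambda>i. {1..r i}" i] by simp
      qed (use a c u r[of 1] n in auto)
    qed
    show "a i = undefined" if "i \<notin> {1..n}" for i
      using that n f(1) PiE_arb[of f "{2..n-1}" "\<lambda>i. {1..r i}" i] by (auto simp: a_def)
  qed
  moreover have "(\<Sum>i=1..n-1. a i) = n - 1 + u + v"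
    unfolding sum_split_first[OF n] using a f(2) n by simp
  then have "excess n a = u + v"
    by (simp add: excess_def)
  ultimately show ?thesis using a by blast
qed

lemma sw_in_index_set:
  assumes "a \<in> index_set n r" "b \<in> index_set n r" "i \<in> {1..n}"
  shows "sw i a b \<in> index_set n r"
  using assms by (auto simp: sw_def index_set_def PiE_iff extensional_def)

text \<open>Stated with both terms on the side where they are added, to avoid truncated subtraction.\<close>

lemma sum_sw:
  assumes "i \<in> {1..n-1}"
  shows "(\<Sum>j=1..n-1. sw i a b j) + a i = (\<Sum>j=1..n-1. a j) + b i"
  using assms by (simp add: sw_def sum.remove[of _ i] cong: sum.cong_simp)

lemma scroll_position_sw_last:
  assumes "1 \<le> n"
  shows "scroll_position n (sw n a b) = (b n, Suc (excess n a))"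
proof -
  have "(\<Sum>j=1..n-1. sw n a b j) = (\<Sum>j=1..n-1. a j)"
    using assms by (intro sum.cong) (auto simp: sw_def)
  then show ?thesis
    by (simp add: scroll_position_def excess_def sw_def)
qed

section \<open>Positions of the variables in the scroll matrix\<close>

text \<open>
  The induced bijection has to be a function on the equivalence classes themselves, so it reads off
  the position from an arbitrary representative.
\<close>

definition class_position :: "nat \<Rightarrow> (nat \<Rightarrow> nat) set \<Rightarrow> nat \<times> nat" where
  "class_position n C = scroll_position n (SOME a. a \<in> C)"

lemma class_position_class:
  assumes "a \<in> index_set n r"
  shows "class_position n (index_rel n r `` {a}) = scroll_position n a"
proof -
  have "a \<in> index_rel n r `` {a}"
    using assms by (simp add: index_rel_def)
  then obtain b where b: "(SOME a'. a' \<in> index_rel n r `` {a}) = b" "(a, b) \<in> index_rel n r"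
    by (metis Image_singleton_iff some_in_eq empty_iff)
  then show ?thesis
    unfolding class_position_def b(1) by (simp add: index_rel_def scroll_position_def excess_def)
qed

lemma bij_betw_class_position:
  assumes n: "2 \<le> n" and r: "\<And>i. i \<in> {1..n} \<Longrightarrow> 1 \<le> r i"
  shows "bij_betw (class_position n) (var_classes n r) (scroll_vars (r n) (\<lambda>_. max_excess n r))"
proof (rule bij_betw_imageI)
  show "inj_on (class_position n) (var_classes n r)"
  proof (rule inj_onI)
    fix C C' assume C: "C \<in> var_classes n r" "C' \<in> var_classes n r"
      and eq: "class_position n C = class_position n C'"
    obtain a b where ab: "a \<in> index_set n r" "C = index_rel n r `` {a}"
      "b \<in> index_set n r" "C' = index_rel n r `` {b}"
      using C by (auto simp: var_classes_def elim!: quotientE)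
    have "scroll_position n a = scroll_position n b"
      using eq ab class_position_class[OF ab(1)] class_position_class[OF ab(3)] by metis
    then have "(a, b) \<in> index_rel n r"
      using ab(1,3) coordinate_sum(1)[OF ab(1)] coordinate_sum(1)[OF ab(3)]
      by (simp add: scroll_position_def index_rel_def)
    then show "C = C'"
      using ab equiv_class_eq[OF equiv_index_rel] by simp
  qed
  show "class_position n ` var_classes n r = scroll_vars (r n) (\<lambda>_. max_excess n r)"
  proof (intro equalityI subsetI)
    fix z assume "z \<in> class_position n ` var_classes n r"
    then obtain a where "a \<in> index_set n r" "z = scroll_position n a"
      by (auto simp: var_classes_def class_position_class elim!: quotientE)
    then show "z \<in> scroll_vars (r n) (\<lambda>_. max_excess n r)"
      using coordinate_sum(2) index_set_last n by (auto simp: scroll_vars_def scroll_position_def)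
  next
    fix z assume "z \<in> scroll_vars (r n) (\<lambda>_. max_excess n r)"
    then obtain c p where z: "z = (c, Suc p)" "c \<in> {1..r n}" "p \<le> max_excess n r"
      by (auto simp: scroll_vars_def) (metis Suc_le_D Suc_le_mono)
    \<comment> \<open>fill the first coordinate up before using the later ones\<close>
    define u where "u = min p (r 1 - 1)"
    have "p - u \<le> (\<Sum>i=2..n-1. r i - 1)"
      using z(3) sum_split_first[OF n, of "\<lambda>i. r i - 1"] by (auto simp: max_excess_def u_def)
    then obtain a where "a \<in> index_set n r" "a n = c" "excess n a = u + (p - u)"
      using index_tuple_exists[where r = r, OF n r z(2), of u "p - u"] by (auto simp: u_def)
    then have "a \<in> index_set n r" "scroll_position n a = z"
      by (simp_all add: z scroll_position_def u_def)
    then show "z \<in> class_position n ` var_classes n r"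
      by (auto simp: var_classes_def intro!: rev_image_eqI[OF quotientI] class_position_class[symmetric])
  qed
qed

section \<open>The two families of binomials generate the same ideal\<close>

text \<open>
  The generating minors come with ordered columns.  For columns in the opposite order the unit
  exchange is the negative of a minor, and for equal columns it vanishes, so all
  unit exchanges lie in the scroll ideal and can be chained.
\<close>

lemma scroll_ideal_exchange:
  fixes D :: nat
  assumes cd: "c \<in> {1..l}" "d \<in> {1..l}"
    and "p + q = p' + q'" "p \<le> D" "q \<le> D" "p' \<le> D" "q' \<le> D"
  shows "Var (c, Suc p) * Var (d, Suc q) - Var (c, Suc p') * Var (d, Suc q')
      \<in> (scroll_ideal l (\<lambda>_. D) :: (nat \<times> nat, 'k::comm_ring_1) mpoly set)"
proof -
  let ?J = "scroll_ideal l (\<lambda>_. D) :: (nat \<times> nat, 'k) mpoly set"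
  interpret S: cring "scroll_ring l (\<lambda>_. D) :: (nat \<times> nat, 'k) mpoly ring"
    unfolding scroll_ring_def by (rule cring_mpoly_ring)
  have J: "ideal ?J (mpoly_ring (scroll_vars l (\<lambda>_. D)))"
    using S.genideal_ideal[OF scroll_minors_carrier]
    by (simp add: scroll_ideal_def scroll_ring_def)
  interpret J: ideal ?J "mpoly_ring (scroll_vars l (\<lambda>_. D)) :: (nat \<times> nat, 'k) mpoly ring"
    by (rule J)
  have zero: "0 \<in> ?J"
    using additive_subgroup.zero_closed[OF J.additive_subgroup_axioms] by simp
  have diff: "x - y \<in> ?J" if "x \<in> ?J" "y \<in> ?J" for x y
    by (rule ideal_mpoly_ring_diff[OF J that])
  have minor: "Var (c, Suc p) * Var (d, Suc (Suc q)) - Var (d, Suc q) * Var (c, Suc (Suc p)) \<in> ?J"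
    if "c \<in> {1..l}" "d \<in> {1..l}" "p < D" "q < D" "column_before (c, Suc p) (d, Suc q)" for c d p q
  proof -
    have "scroll_entry 1 (c, Suc p) * scroll_entry 2 (d, Suc q)
        - scroll_entry 1 (d, Suc q) * scroll_entry 2 (c, Suc p) \<in> scroll_minors l (\<lambda>_. D)"
      using that unfolding scroll_minors_def scroll_columns_def by fastforce
    then show ?thesis
      using S.genideal_self[OF scroll_minors_carrier]
      by (auto simp: scroll_ideal_def scroll_entry_def)
  qed
  have "Var (c, Suc p) * Var (d, Suc (Suc q)) - Var (c, Suc (Suc p)) * Var (d, Suc q) \<in> ?J"
    if pq: "p < D" "q < D" for p q
  proof -
    consider "column_before (c, Suc p) (d, Suc q)" | "column_before (d, Suc q) (c, Suc p)"
      | "(c, p) = (d, q)"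
      unfolding column_before_def by fastforce
    then show ?thesis
    proof cases
      case 1
      then show ?thesis using minor[OF cd pq] by (simp add: mult.commute)
    next
      case 2
      then show ?thesis
        using diff[OF zero minor[OF cd(2,1) pq(2,1)]] by (simp add: mult.commute)
    next
      case 3
      then show ?thesis using zero by (simp add: mult.commute)
    qed
  qed
  then show ?thesis
    using exchange_from_steps[where J = ?J and F = "\<lambda>p q. Var (c, Suc p) * Var (d, Suc q)"]
      zero diff assms(3-) by blast
qed

text \<open>The switch binomial written in the variables of the scroll.\<close>

definition position_binomial ::
  "nat \<Rightarrow> nat \<Rightarrow> (nat \<Rightarrow> nat) \<Rightarrow> (nat \<Rightarrow> nat) \<Rightarrow> (nat \<times> nat, 'k::comm_ring_1) mpoly" where
  "position_binomial n i a b =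
     Var (scroll_position n a) * Var (scroll_position n b)
     - Var (scroll_position n (sw i a b)) * Var (scroll_position n (sw i b a))"

lemma rename_vars_switch_binomial:
  assumes "a \<in> index_set n r" "b \<in> index_set n r" "i \<in> {1..n}"
  shows "rename_vars (class_position n) (switch_binomial n r i a b) = position_binomial n i a b"
proof -
  have x: "rename_vars (class_position n) (xvar n r a) = Var (scroll_position n a)"
    if "a \<in> index_set n r" for a
    using class_position_class[OF that] by (simp add: xvar_def Var_def)
  show ?thesis
    using assms sw_in_index_set
    by (simp add: switch_binomial_def position_binomial_def push_diff push_mult push_add x)
qed

text \<open>
  A switch in coordinate \<open>n\<close> exchanges the last coordinates of \<open>a\<close> and \<open>b\<close>, so after commuting the
  factors it is the exchange from excesses \<open>(p, q)\<close> to \<open>(q, p)\<close>.  A switch in any other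
  coordinate fixes the last coordinates and the total of the two excesses.
\<close>

lemma position_binomial_in_scroll_ideal:
  assumes n: "1 \<le> n" and a: "a \<in> index_set n r" and b: "b \<in> index_set n r" and i: "i \<in> {1..n}"
  shows "position_binomial n i a b \<in> scroll_ideal (r n) (\<lambda>_. max_excess n r)"
proof (cases "i = n")
  case True
  show ?thesis
    using scroll_ideal_exchange[OF index_set_last[OF a n] index_set_last[OF b n] add.commute
        coordinate_sum(2)[OF a] coordinate_sum(2)[OF b] coordinate_sum(2)[OF b] coordinate_sum(2)[OF a]]
      scroll_position_sw_last[OF n]
    by (simp add: True position_binomial_def scroll_position_def mult.commute)
next
  case False
  then have i': "i \<in> {1..n-1}" using i by auto
  note ab = a b sw_in_index_set[OF a b i] sw_in_index_set[OF b a i]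
  have "excess n a + excess n b = excess n (sw i a b) + excess n (sw i b a)"
    using sum_sw[OF i', of a b] sum_sw[OF i', of b a] ab[THEN coordinate_sum(1)] by linarith
  from scroll_ideal_exchange[OF index_set_last[OF a n] index_set_last[OF b n] this
      ab[THEN coordinate_sum(2)]]
  show ?thesis
    using False by (simp add: position_binomial_def scroll_position_def sw_def)
qed

lemma position_binomial_first:
  assumes n: "3 \<le> n" and a: "a \<in> index_set n r" "a 1 = Suc u" "excess n a = u + v"
    and b: "b \<in> index_set n r" "b 1 = Suc u'" "excess n b = u' + v'"
  shows "position_binomial n 1 a b =
    Var (a n, Suc (u + v)) * Var (b n, Suc (u' + v')) - Var (a n, Suc (u' + v)) * Var (b n, Suc (u + v'))"
proof -
  have 1: "1 \<in> {1..n-1}" "1 \<in> {1..n}" using n by auto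
  have "excess n (sw 1 a b) = u' + v" "excess n (sw 1 b a) = u + v'"
    using sum_sw[OF 1(1), of a b] sum_sw[OF 1(1), of b a] a b
      coordinate_sum(1)[OF a(1)] coordinate_sum(1)[OF b(1)]
      coordinate_sum(1)[OF sw_in_index_set[OF a(1) b(1) 1(2)]]
      coordinate_sum(1)[OF sw_in_index_set[OF b(1) a(1) 1(2)]]
    by linarith+
  moreover have "sw 1 a b n = a n" "sw 1 b a n = b n"
    using n by (simp_all add: sw_def)
  ultimately show ?thesis
    using a(3) b(3) by (simp add: position_binomial_def scroll_position_def)
qed

text \<open>
  Choosing indices with prescribed first coordinates and surpluses realises every switch
  required by \<open>step_from_switches\<close>, with \<open>A\<close> the range of the first coordinate and
  \<open>B\<close> that of the coordinates \<open>2, \<dots>, n - 1\<close>.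
\<close>

lemma scroll_minors_from_switches:
  fixes J :: "(nat \<times> nat, 'k::comm_ring_1) mpoly set"
  assumes n: "3 \<le> n" and r: "\<And>i. i \<in> {1..n} \<Longrightarrow> 2 \<le> r i"
    and diff: "\<And>x y. x \<in> J \<Longrightarrow> y \<in> J \<Longrightarrow> x - y \<in> J"
    and J: "\<And>a b. a \<in> index_set n r \<Longrightarrow> b \<in> index_set n r \<Longrightarrow> position_binomial n 1 a b \<in> J"
  shows "scroll_minors (r n) (\<lambda>_. max_excess n r) \<subseteq> J"
proof
  fix x :: "(nat \<times> nat, 'k) mpoly"
  assume "x \<in> scroll_minors (r n) (\<lambda>_. max_excess n r)"
  then obtain c j d k where cd: "c \<in> {1..r n}" "d \<in> {1..r n}"
    and jk: "j \<in> {1..max_excess n r}" "k \<in> {1..max_excess n r}"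
    and x: "x = Var (c, j) * Var (d, Suc k) - Var (d, k) * Var (c, Suc j)"
    unfolding scroll_minors_def scroll_columns_def scroll_entry_def by auto
  define A B where "A = r 1 - 1" and "B = (\<Sum>i=2..n-1. r i - 1)"
  have AB: "max_excess n r = A + B"
    using n sum_split_first[of n "\<lambda>i. r i - 1"] by (simp add: max_excess_def A_def B_def)
  have A: "1 \<le> A"
    using r[of 1] n by (simp add: A_def)
  have "r 2 - 1 \<le> B"
    unfolding B_def using n by (intro member_le_sum) auto
  then have B: "1 \<le> B"
    using r[of 2] n by simp
  define F :: "nat \<Rightarrow> nat \<Rightarrow> (nat \<times> nat, 'k) mpoly"
    where "F p q = Var (c, Suc p) * Var (d, Suc q)" for p q
  have "F (u + v) (u' + v') - F (u' + v) (u + v') \<in> J"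
    if uv: "u \<le> A" "u' \<le> A" "v \<le> B" "v' \<le> B" for u v u' v'
  proof -
    have r1: "1 \<le> r i" if "i \<in> {1..n}" for i
      using r[OF that] by simp
    have n2: "2 \<le> n" using n by simp
    obtain a where a: "a \<in> index_set n r" "a n = c" "a 1 = Suc u" "excess n a = u + v"
      using index_tuple_exists[where r = r, OF n2 r1 cd(1), of u v] uv A_def B_def by auto
    obtain b where b: "b \<in> index_set n r" "b n = d" "b 1 = Suc u'" "excess n b = u' + v'"
      using index_tuple_exists[where r = r, OF n2 r1 cd(2), of u' v'] uv A_def B_def by auto
    show ?thesis
      using J[OF a(1) b(1)]
      unfolding position_binomial_first[OF n a(1,3,4) b(1,3,4)] F_def by (simp add: a(2) b(2))
  qed
  then have "F (j - 1) (Suc (k - 1)) - F (Suc (j - 1)) (k - 1) \<in> J"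
    using jk AB by (intro step_from_switches[OF diff _ A B]) auto
  then show "x \<in> J"
    using jk by (simp add: x F_def mult.commute)
qed

theorem corollary6p4:
  fixes n t :: nat and r :: "nat \<Rightarrow> nat"
  assumes "n \<ge> 3"
    and "\<And>i. i \<in> {1..n} \<Longrightarrow> r i \<ge> 2"
    and "t \<in> {1..n}"
  shows "\<exists>(l::nat) (\<sigma> :: nat \<Rightarrow> nat) (\<phi> :: (nat \<Rightarrow> nat) set \<Rightarrow> nat \<times> nat)
           (\<Phi> :: ((nat \<Rightarrow> nat) set, 'k::field) mpoly \<Rightarrow> (nat \<times> nat, 'k) mpoly).
           l \<ge> 1 \<and> (\<forall>i \<in> {1..l}. \<sigma> i \<ge> 1) \<and> mono_on {1..l} \<sigma> \<and>
           bij_betw \<phi> (var_classes n r) (scroll_vars l \<sigma>) \<and>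
           induced_iso (var_classes n r) (scroll_vars l \<sigma>) \<phi> \<Phi> \<and>
           \<Phi> ` (switch_ideal n r t) = scroll_ideal l \<sigma>"
proof -
  define \<sigma> :: "nat \<Rightarrow> nat" where "\<sigma> = (\<lambda>_. max_excess n r)"
  define \<Phi> :: "((nat \<Rightarrow> nat) set, 'k) mpoly \<Rightarrow> (nat \<times> nat, 'k) mpoly"
    where "\<Phi> = rename_vars (class_position n)"
  let ?V = "var_classes n r" and ?W = "scroll_vars (r n) \<sigma>"
  let ?S = "mpoly_ring ?W :: (nat \<times> nat, 'k) mpoly ring"
  let ?G = "switch_generators n r t :: ((nat \<Rightarrow> nat) set, 'k) mpoly set"
  have tn: "t \<le> n" and t1: "1 \<in> {1..t}"
    using assms(3) by auto
  have r1: "1 \<le> r i" if "i \<in> {1..n}" for i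
    using assms(2)[OF that] by simp
  have bij: "bij_betw (class_position n) ?V ?W"
    unfolding \<sigma>_def using assms(1) r1 by (intro bij_betw_class_position) auto
  have iso: "induced_iso ?V ?W (class_position n) \<Phi>"
    unfolding \<Phi>_def by (rule rename_vars_induced_iso[OF bij])
  interpret R: cring "mpoly_ring ?V :: ((nat \<Rightarrow> nat) set, 'k) mpoly ring"
    by (rule cring_mpoly_ring)
  interpret S: cring ?S
    by (rule cring_mpoly_ring)
  have G: "?G \<subseteq> carrier (mpoly_ring ?V)"
    using switch_generators_carrier[OF tn] by (simp add: switch_ring_def)
  have \<Phi>iso: "\<Phi> \<in> ring_iso (mpoly_ring ?V) ?S"
    using iso by (simp add: induced_iso_def)
  have img: "\<Phi> ` switch_ideal n r t = Idl\<^bsub>?S\<^esub> (\<Phi> ` ?G)"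
    unfolding switch_ideal_def switch_ring_def
    by (rule ring_iso_image_genideal[OF R.ring_axioms S.ring_axioms \<Phi>iso G])
  have \<Phi>G: "\<Phi> ` ?G = {position_binomial n i a b | i a b.
      i \<in> {1..t} \<and> a \<in> index_set n r \<and> b \<in> index_set n r}"
  proof -
    have "\<Phi> (switch_binomial n r i a b) = position_binomial n i a b"
      if "i \<in> {1..t}" "a \<in> index_set n r" "b \<in> index_set n r" for i a b
      unfolding \<Phi>_def using that tn by (intro rename_vars_switch_binomial) auto
    then show ?thesis
      unfolding switch_generators_def by (auto simp: image_iff) metis+
  qed
  have \<Phi>G_carrier: "\<Phi> ` ?G \<subseteq> carrier ?S"
    using G \<Phi>iso by (auto simp: ring_iso_def ring_hom_def)
  have minors_carrier: "scroll_minors (r n) \<sigma> \<subseteq> carrier ?S"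
    using scroll_minors_carrier by (simp add: scroll_ring_def)
  have scroll: "scroll_ideal (r n) \<sigma> = Idl\<^bsub>?S\<^esub> (scroll_minors (r n) \<sigma>)"
    by (simp add: scroll_ideal_def scroll_ring_def)
  have "\<Phi> ` switch_ideal n r t = scroll_ideal (r n) \<sigma>"
  proof
    have "\<Phi> ` ?G \<subseteq> scroll_ideal (r n) \<sigma>"
      unfolding \<Phi>G \<sigma>_def using assms(1) tn
      by (auto intro!: position_binomial_in_scroll_ideal)
    then show "\<Phi> ` switch_ideal n r t \<subseteq> scroll_ideal (r n) \<sigma>"
      unfolding img scroll by (intro S.genideal_minimal S.genideal_ideal minors_carrier)
    have ideal: "ideal (Idl\<^bsub>?S\<^esub> (\<Phi> ` ?G)) ?S"
      by (rule S.genideal_ideal[OF \<Phi>G_carrier])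
    have "position_binomial n 1 a b \<in> Idl\<^bsub>?S\<^esub> (\<Phi> ` ?G)"
      if "a \<in> index_set n r" "b \<in> index_set n r" for a b
      using S.genideal_self[OF \<Phi>G_carrier] that t1 unfolding \<Phi>G by blast
    then have "scroll_minors (r n) \<sigma> \<subseteq> Idl\<^bsub>?S\<^esub> (\<Phi> ` ?G)"
      unfolding \<sigma>_def using ideal_mpoly_ring_diff[OF ideal] assms(1,2)
      by (intro scroll_minors_from_switches) (auto simp: \<sigma>_def)
    then show "scroll_ideal (r n) \<sigma> \<subseteq> \<Phi> ` switch_ideal n r t"
      unfolding img scroll by (intro S.genideal_minimal ideal)
  qed
  moreover have "1 \<le> max_excess n r"
  proof -
    have "r 1 - 1 \<le> max_excess n r"
      unfolding max_excess_def using assms(1) by (intro member_le_sum) auto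
    then show ?thesis using assms(1) assms(2)[of 1] by simp
  qed
  moreover have "1 \<le> r n"
    using r1[of n] assms(1) by simp
  ultimately show ?thesis
    using bij iso by (intro exI[of _ "r n"] exI[of _ \<sigma>] exI[of _ "class_position n"] exI[of _ \<Phi>])
      (auto simp: \<sigma>_def mono_on_def)
qed

end
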